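(* In any phase of Algorithm A, the number of requests $r^t$ of that phase such that the algorithm's current state $q^t$ does not satisfy $r^t$ is at most $2^k$.
   Context: Setting: generalized $k$-server in the uniform metric case, where each server $i\in[k]$ lives in a uniform metric with point set $[n]$ and unit distances. A state (configuration) is $q=(q_1,\dots,q_k)\in[n]^k$ and a request is $r=(r_1,\dots,r_k)\in[n]^k$; the state $q$ satisfies $r$ if $q_i=r_i$ for some $i\in[k]$. Algorithm A works in phases. When a phase begins, the algorithm is in some arbitrary state. Number the requests of the current phase $r^1,r^2,\dots$ and let $q^t$ be the state when $r^t$ arrives. On arrival of $r^t$: if $q^t$ satisfies $r^t$, set $q^{t+1}=q^t$. Otherwise, if there exists a state $q$ satisfying all of $r^1,\dots,r^t$, set $q^{t+1}$ to (any) such $q$; if no such state exists, set $q^{t+1}$ to an arbitrary state satisfying $r^t$ and end the current phase (the next request begins a new phase). *)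

theory Defs
  imports "HOL-Library.FuncSet" "HOL-Library.Extended_Nat"
begin

text \<open>A state and a request have the same form: for each server, a point of its metric space.\<close>

type_synonym config = "nat \<Rightarrow> nat"

definition configs :: "nat \<Rightarrow> nat \<Rightarrow> config set" where
  "configs k n = {1..k} \<rightarrow>\<^sub>E {1..n}"

definition satisfies :: "nat \<Rightarrow> config \<Rightarrow> config \<Rightarrow> bool" where
  "satisfies k q r \<longleftrightarrow> (\<exists>i\<in>{1..k}. q i = r i)"

text \<open>
  Time is global and starts at 0: \<open>r t\<close> is the request arriving at time \<open>t\<close>, \<open>q t\<close> the
  state of the algorithm at its arrival, and \<open>p t\<close> the number of the phase that \<open>r t\<close>
  belongs to.  Thus the requests of the current phase up to time \<open>t\<close> are the \<open>r s\<close> with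
  \<open>s \<in> phase_upto p t\<close>.
\<close>

definition phase_upto :: "(nat \<Rightarrow> nat) \<Rightarrow> nat \<Rightarrow> nat set" where
  "phase_upto p t = {s. s \<le> t \<and> p s = p t}"

definition satisfies_phase ::
    "nat \<Rightarrow> (nat \<Rightarrow> config) \<Rightarrow> (nat \<Rightarrow> nat) \<Rightarrow> nat \<Rightarrow> config \<Rightarrow> bool" where
  "satisfies_phase k r p t x \<longleftrightarrow> (\<forall>s\<in>phase_upto p t. satisfies k x (r s))"

definition alg_step ::
    "nat \<Rightarrow> nat \<Rightarrow> (nat \<Rightarrow> config) \<Rightarrow> (nat \<Rightarrow> config) \<Rightarrow> (nat \<Rightarrow> nat) \<Rightarrow> nat \<Rightarrow> bool" where
  "alg_step k n r q p t \<longleftrightarrow>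
     (if satisfies k (q t) (r t) then
        q (Suc t) = q t \<and> p (Suc t) = p t
      else if \<exists>x\<in>configs k n. satisfies_phase k r p t x then
        q (Suc t) \<in> configs k n \<and> satisfies_phase k r p t (q (Suc t)) \<and> p (Suc t) = p t
      else
        q (Suc t) \<in> configs k n \<and> satisfies k (q (Suc t)) (r t) \<and> p (Suc t) = Suc (p t))"

text \<open>
  The request sequence has length \<open>N\<close>, possibly infinite.  The free choices of the algorithm
  (initial state, next state) are arbitrary, hence a run is a relation rather than a function
  of \<open>r\<close>.
\<close>

definition alg_run ::
    "nat \<Rightarrow> nat \<Rightarrow> enat \<Rightarrow> (nat \<Rightarrow> config) \<Rightarrow> (nat \<Rightarrow> config) \<Rightarrow> (nat \<Rightarrow> nat) \<Rightarrow> bool" where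
  "alg_run k n N r q p \<longleftrightarrow>
     q 0 \<in> configs k n \<and> p 0 = 0 \<and>
     (\<forall>t. enat t < N \<longrightarrow> r t \<in> configs k n \<and> alg_step k n r q p t)"

definition unsatisfied_in_phase ::
    "nat \<Rightarrow> enat \<Rightarrow> (nat \<Rightarrow> config) \<Rightarrow> (nat \<Rightarrow> config) \<Rightarrow> (nat \<Rightarrow> nat) \<Rightarrow> nat \<Rightarrow> nat set" where
  "unsatisfied_in_phase k N r q p j =
     {t. enat t < N \<and> p t = j \<and> \<not> satisfies k (q t) (r t)}"

end

theory Submission
  imports Defs "HOL-Library.Function_Algebras"
begin

text \<open>
  Attach to each request \<open>r t\<close> that finds the algorithm in a state not satisfying it the
  polynomial \<open>x \<mapsto> \<Prod>i=1..k. (x i - r t i)\<close>, which vanishes exactly at the states satisfying \<open>r t\<close>.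
  A state \<open>q t\<close> satisfies all earlier requests of its phase but not \<open>r t\<close>, so these
  polynomials form a triangular system and are linearly independent.  They lie in the span of
  the \<open>2 ^ k\<close> squarefree monomials in \<open>k\<close> variables.
\<close>

interpretation real_fun: vector_space "\<lambda>(c::real) (f :: 'x \<Rightarrow> real) x. c * f x"
  by unfold_locales (auto simp: fun_eq_iff algebra_simps)

text \<open>Insert the indices in increasing order: evaluation at \<open>x b\<close> for the largest
  index \<open>b\<close> is a linear functional that vanishes on every earlier \<open>f u\<close>,
  hence on their span, but not on \<open>f b\<close>.\<close>

lemma triangular_independent:
  fixes f :: "'a::linorder \<Rightarrow> 'x \<Rightarrow> real"
  assumes "finite A"
    and "\<And>v. v \<in> A \<Longrightarrow> f v (x v) \<noteq> 0"
    and "\<And>u v. u \<in> A \<Longrightarrow> v \<in> A \<Longrightarrow> u < v \<Longrightarrow> f u (x v) = 0"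
  shows "real_fun.independent (f ` A)"
  using assms
proof (induction A rule: finite_linorder_max_induct)
  case empty
  then show ?case
    using real_fun.independent_empty by simp
next
  case (insert b A)
  have "real_fun.subspace {g :: 'x \<Rightarrow> real. g (x b) = 0}"
    by (auto simp: real_fun.subspace_def)
  moreover have "f ` A \<subseteq> {g. g (x b) = 0}"
    using insert by auto
  ultimately have "real_fun.span (f ` A) \<subseteq> {g. g (x b) = 0}"
    by (rule real_fun.span_minimal[rotated])
  moreover have "f b (x b) \<noteq> 0"
    using insert.prems by simp
  ultimately have "f b \<notin> real_fun.span (f ` A)"
    by auto
  then show ?case
    using insert by (simp add: real_fun.independent_insertI)
qed

lemma triangular_card_le:
  fixes f :: "'a::linorder \<Rightarrow> 'x \<Rightarrow> real"
  assumes "finite T" and "f ` A \<subseteq> real_fun.span T"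
    and diag: "\<And>v. v \<in> A \<Longrightarrow> f v (x v) \<noteq> 0"
    and upper: "\<And>u v. u \<in> A \<Longrightarrow> v \<in> A \<Longrightarrow> u < v \<Longrightarrow> f u (x v) = 0"
  shows "finite A \<and> card A \<le> card T"
\<comment> \<open>\<open>A\<close> may be infinite a priori, as a phase may never end. A uniform
  bound on the finite subsets gives finiteness and the bound together.\<close>
proof (rule finite_if_finite_subsets_card_bdd)
  fix G assume G: "G \<subseteq> A" "finite G"
  have "real_fun.independent (f ` G)"
    by (rule triangular_independent[OF G(2), where x = x])
      (use G(1) in \<open>auto intro!: diag upper\<close>)
  moreover have "f ` G \<subseteq> real_fun.span T"
    using assms(2) G(1) by (meson image_mono order_trans)
  ultimately have "card (f ` G) \<le> card T"
    using real_fun.independent_span_bound[OF assms(1)] by simp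
  moreover have "inj_on f G"
  proof (rule linorder_inj_onI')
    fix u v assume "u \<in> G" "v \<in> G" "u < v"
    then have "f u (x v) = 0" "f v (x v) \<noteq> 0"
      using G(1) by (auto intro!: diag upper)
    then show "f u \<noteq> f v"
      by auto
  qed
  ultimately show "card G \<le> card T"
    by (simp add: card_image)
qed

lemma sum_fun_apply: "(\<Sum>i\<in>I. h i) x = (\<Sum>i\<in>I. h i x)"
  by (induction I rule: infinite_finite_induct) auto

text \<open>Expand the product: \<open>S\<close> collects the factors that contribute
  \<open>g i x\<close>, and the others contribute the constant coefficient.\<close>

lemma prod_diff_in_span_monomials:
  fixes c :: "'i \<Rightarrow> real" and g :: "'i \<Rightarrow> 'x \<Rightarrow> real"
  assumes "finite I"
  shows "(\<lambda>x. \<Prod>i\<in>I. g i x - c i) \<in> real_fun.span ((\<lambda>S x. \<Prod>i\<in>S. g i x) ` Pow I)"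
    (is "_ \<in> real_fun.span (?m ` Pow I)")
proof -
  have "(\<lambda>x. \<Prod>i\<in>I. g i x - c i) = (\<Sum>S\<in>Pow I. (\<lambda>x. (\<Prod>i\<in>I - S. - c i) * ?m S x))"
  proof
    fix x
    show "(\<Prod>i\<in>I. g i x - c i) = (\<Sum>S\<in>Pow I. (\<lambda>x. (\<Prod>i\<in>I - S. - c i) * ?m S x)) x"
      using prod_add[OF assms, of "\<lambda>i. g i x" "\<lambda>i. - c i"]
      by (simp add: sum_fun_apply mult.commute)
  qed
  also have "\<dots> \<in> real_fun.span (?m ` Pow I)"
    by (intro real_fun.span_sum real_fun.span_scale real_fun.span_base) auto
  finally show ?thesis .
qed

lemma phase_mono:
  assumes "alg_run k n N r q p" "enat v < N" "u \<le> v"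
  shows "p u \<le> p v"
  using assms(3,2)
proof (induction rule: dec_induct)
  case (step m)
  then have "enat m < N"
    by (metis enat_ord_simps(2) lessI less_trans)
  then have "alg_step k n r q p m"
    using assms(1) by (simp add: alg_run_def)
  then have "p m \<le> p (Suc m)"
    by (auto simp: alg_step_def split: if_splits)
  then show ?case
    using step \<open>enat m < N\<close> by simp
qed simp

text \<open>Within a phase the state either stays put, having satisfied the current request, or
  moves to a state satisfying all requests of the phase so far.\<close>

lemma satisfies_earlier_in_phase:
  assumes run: "alg_run k n N r q p" and "enat v < N" "u < v" "p u = p v"
  shows "satisfies k (q v) (r u)"
  using assms(3,2,4)
proof (induction v)
  case (Suc v)
  have v: "enat v < N"
    using Suc.prems(2) by (metis enat_ord_simps(2) lessI less_trans)
  \<comment> \<open>As \<open>p u = p (Suc v)\<close>, monotonicity squeezes \<open>p v\<close>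
    between them. So the step at \<open>v\<close> does not end the phase, which excludes the last
    branch of \<open>alg_step\<close>.\<close>
  have "p u \<le> p v" "p v \<le> p (Suc v)"
    using phase_mono[OF run v, of u] phase_mono[OF run Suc.prems(2), of v] Suc.prems(1)
    by simp_all
  then have p: "p u = p v" "p (Suc v) = p v"
    using Suc.prems by auto
  have step: "alg_step k n r q p v"
    using run v by (simp add: alg_run_def)
  show ?case
  proof (cases "satisfies k (q v) (r v)")
    case True
    then have "q (Suc v) = q v"
      using step by (simp add: alg_step_def)
    then show ?thesis
      using True Suc v p by (metis less_antisym)
  next
    case False
    then have "satisfies_phase k r p v (q (Suc v))"
      using step p by (auto simp: alg_step_def split: if_splits)
    then show ?thesis
      using Suc.prems p by (simp add: satisfies_phase_def phase_upto_def)
  qed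
qed simp

theorem theorem4:
  fixes k n :: nat and N :: enat and r q :: "nat \<Rightarrow> config" and p :: "nat \<Rightarrow> nat" and j :: nat
  assumes "alg_run k n N r q p"
  shows "finite (unsatisfied_in_phase k N r q p j) \<and>
         card (unsatisfied_in_phase k N r q p j) \<le> 2 ^ k"
proof -
  let ?U = "unsatisfied_in_phase k N r q p j"
  \<comment> \<open>The casts come before the subtraction: truncated subtraction on
    \<open>nat\<close> would also vanish when \<open>x i < r t i\<close>.\<close>
  let ?f = "\<lambda>t (x::config). \<Prod>i\<in>{1..k}. real (x i) - real (r t i)"
  let ?T = "(\<lambda>S (x::config). \<Prod>i\<in>S. real (x i)) ` Pow {1..k}"
  have f_eq_0: "?f t x = 0 \<longleftrightarrow> satisfies k x (r t)" for t x
    by (auto simp: satisfies_def)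
  have "finite ?U \<and> card ?U \<le> card ?T"
  proof (rule triangular_card_le[where f = ?f and x = q])
    show "?f ` ?U \<subseteq> real_fun.span ?T"
      by (intro image_subsetI prod_diff_in_span_monomials finite_atLeastAtMost)
  next
    fix v assume "v \<in> ?U"
    then show "?f v (q v) \<noteq> 0"
      unfolding f_eq_0 by (simp add: unsatisfied_in_phase_def)
  next
    fix u v assume "u \<in> ?U" "v \<in> ?U" "u < v"
    then show "?f u (q v) = 0"
      unfolding f_eq_0
      by (intro satisfies_earlier_in_phase[OF assms]) (simp_all add: unsatisfied_in_phase_def)
  qed simp
  moreover have "card ?T \<le> 2 ^ k"
    using card_image_le[of "Pow {1..k}"] by (simp add: card_Pow)
  ultimately show ?thesis
    by (meson le_trans)
qed

end
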